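(* For every $n\ge1$ let $\mathbf{x}^n=(\mathrm x^n_i)_{i\ge1}\in\{-1,+1\}^{\mathbb N}$ be a sequence such that $\tau(\mathbf{x}^n)>n$. Write $\mathcal T_n=\mathcal T_n(\mathbf{x}^n)$, $S^n_k=S_k(\mathbf{x}^n)$ for $0\le k\le n$, and $$\mathsf h^+_n=\sum_{i=1}^n\frac{1}{S^n_i}\mathbf 1_{\{\mathrm x^n_i=1\}}.$$ Then the following hold. (I) Let $U^n$ be an active vertex of $\mathcal T_n$ chosen uniformly at random, and denote by $\mathsf H(U^n)$ its height. Then for all $p\ge1$, $\mathsf H(U^n)/\mathsf h^+_n\to 1$ in $\mathbb L^p$ as $n\to\infty$. (II) For all $\varepsilon\in(0,1)$, $$\mathbb P\left(1-\varepsilon\le\frac{\mathsf{Height}(\mathcal T_n)}{\mathsf h^+_n}\le e+\varepsilon\right)\longrightarrow 1\quad\text{as } n\to\infty.$$ (III) Assume that $\ln(n)/\mathsf h^+_n\to0$ as $n\to\infty$. Then for all $p\ge1$, $\mathsf{Height}(\mathcal T_n)/\mathsf h^+_n\to1$ in $\mathbb L^p$ as $n\to\infty$.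
   Context: $\mathbb N=\{1,2,3,\dots\}$. For $\mathbf{x}=(\mathrm x_i)_{i\ge1}\in\{-1,+1\}^{\mathbb N}$ set $S_0(\mathbf{x})=1$, $S_n(\mathbf{x})=1+\sum_{i=1}^n \mathrm x_i$, and $\tau(\mathbf{x})=\inf\{n\ge1: S_n(\mathbf{x})=0\}$ (with $\inf\varnothing=\infty$). Uniform attachment with freezing (Algorithm 1). Given $\mathbf{x}$, random rooted, labelled trees $(\mathcal T_n(\mathbf{x}))_{n\ge0}$ are built recursively. $\mathcal T_0(\mathbf{x})$ is a single root vertex labelled $a$. For $n\ge1$, if $\mathcal T_{n-1}(\mathbf{x})$ has no vertex labelled $a$, set $\mathcal T_n(\mathbf{x})=\mathcal T_{n-1}(\mathbf{x})$. Otherwise let $V_n$ be a uniformly random vertex labelled $a$ of $\mathcal T_{n-1}(\mathbf{x})$, chosen independently of the previous choices; if $\mathrm x_n=-1$, $\mathcal T_n(\mathbf{x})$ is obtained by replacing the label $a$ of $V_n$ by $n$ (the vertex is "frozen"); if $\mathrm x_n=+1$, $\mathcal T_n(\mathbf{x})$ is obtained by adding an edge labelled $n$ between $V_n$ and a new vertex labelled $a$. Vertices labelled $a$ are called active. The height of a vertex is its graph distance to the root, and $\mathsf{Height}(T)$ is the maximal height of a vertex of $T$. $U^n$ is chosen uniformly conditionally given $\mathcal T_n$. *)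

theory Defs
  imports "HOL-Probability.Probability"
begin

(* A sign sequence is x :: nat => int; only the entries x i with i >= 1 are used. *)

definition walk :: "(nat \<Rightarrow> int) \<Rightarrow> nat \<Rightarrow> int" where
  "walk x n = 1 + (\<Sum>i=1..n. x i)"

definition hitting_time :: "(nat \<Rightarrow> int) \<Rightarrow> enat" where
  "hitting_time x = Inf (enat ` {n. 1 \<le> n \<and> walk x n = 0})"

definition h_plus :: "(nat \<Rightarrow> int) \<Rightarrow> nat \<Rightarrow> real" where
  "h_plus x n = (\<Sum>i=1..n. 1 / real_of_int (walk x i) * indicator {i. x i = 1} i)"

datatype vlabel = Active | Frozen nat

(* The vertices and the edges (two-element sets of vertices) of a tree are the domains
   of its two labelling maps. *)
record ltree =
  root_vertex :: nat
  vertex_label :: "nat \<rightharpoonup> vlabel"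
  edge_label :: "nat set \<rightharpoonup> nat"

definition vertices :: "ltree \<Rightarrow> nat set" where
  "vertices T = dom (vertex_label T)"

definition active_vertices :: "ltree \<Rightarrow> nat set" where
  "active_vertices T = {v. vertex_label T v = Some Active}"

definition adjacency :: "ltree \<Rightarrow> (nat \<times> nat) set" where
  "adjacency T = {(u, v). {u, v} \<in> dom (edge_label T)}"

definition graph_distance :: "ltree \<Rightarrow> nat \<Rightarrow> nat \<Rightarrow> nat" where
  "graph_distance T u v = (LEAST k. (u, v) \<in> adjacency T ^^ k)"

definition vertex_height :: "ltree \<Rightarrow> nat \<Rightarrow> nat" where
  "vertex_height T v = graph_distance T (root_vertex T) v"

definition tree_height :: "ltree \<Rightarrow> nat" where
  "tree_height T = Max (vertex_height T ` vertices T)"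

definition initial_tree :: ltree where
  "initial_tree = \<lparr>root_vertex = 0, vertex_label = [0 \<mapsto> Active], edge_label = Map.empty\<rparr>"

definition freeze :: "nat \<Rightarrow> nat \<Rightarrow> ltree \<Rightarrow> ltree" where
  "freeze n v T = T\<lparr>vertex_label := (vertex_label T)(v \<mapsto> Frozen n)\<rparr>"

(* The vertex added at step n is named n. It is new, since the root is named 0 and each
   step adds at most one vertex. *)
definition attach :: "nat \<Rightarrow> nat \<Rightarrow> ltree \<Rightarrow> ltree" where
  "attach n v T = T\<lparr>vertex_label := (vertex_label T)(n \<mapsto> Active),
                    edge_label := (edge_label T)({v, n} \<mapsto> n)\<rparr>"

(* uaf x n is the law of the random tree after n steps. *)
primrec uaf :: "(nat \<Rightarrow> int) \<Rightarrow> nat \<Rightarrow> ltree pmf" where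
  "uaf x 0 = return_pmf initial_tree"
| "uaf x (Suc n) = bind_pmf (uaf x n) (\<lambda>T.
     if active_vertices T = {} then return_pmf T
     else map_pmf
       (\<lambda>v. if x (Suc n) = -1 then freeze (Suc n) v T else attach (Suc n) v T)
       (pmf_of_set (active_vertices T)))"

(* Joint law of the tree and of an active vertex chosen uniformly given the tree. *)
definition uaf_active :: "(nat \<Rightarrow> int) \<Rightarrow> nat \<Rightarrow> (ltree \<times> nat) pmf" where
  "uaf_active x n = bind_pmf (uaf x n) (\<lambda>T.
     map_pmf (\<lambda>u. (T, u)) (pmf_of_set (active_vertices T)))"

(* Convergence in L^p to a constant of random variables X n, n >= 1, where X n is defined
   on the probability space D n. The integrability clause says that X n lies in L^p; without
   it the expectation could be 0 by convention. *)
definition converges_in_Lp ::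
  "real \<Rightarrow> (nat \<Rightarrow> 'a pmf) \<Rightarrow> (nat \<Rightarrow> 'a \<Rightarrow> real) \<Rightarrow> real \<Rightarrow> bool" where
  "converges_in_Lp p D X c \<longleftrightarrow>
     (\<forall>n\<ge>1. integrable (measure_pmf (D n)) (\<lambda>\<omega>. \<bar>X n \<omega>\<bar> powr p)) \<and>
     (\<lambda>n. measure_pmf.expectation (D n) (\<lambda>\<omega>. \<bar>X n \<omega> - c\<bar> powr p)) \<longlonglongrightarrow> 0"

end

theory Submission
  imports Defs
begin

text \<open>
  Let \<open>H\<close> be the height of a uniform active vertex at time \<open>n\<close> and \<open>h\<close> the value of \<open>h_plus\<close>.
  Freezing a uniform active vertex does not change, on average, the proportions of active vertices
  of each height. An up-step that leads to \<open>S\<close> active vertices replaces a fraction \<open>1/S\<close> of them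
  by the new vertex, which is one higher than a uniform active vertex. Hence \<open>H\<close> has the law
  of a sum of independent Bernoulli variables of parameters \<open>1/S\<^sub>i\<close>, over the up-steps \<open>i\<close>.
  This is \<open>expectation_active_gf\<close>, in terms of generating functions; the mean of \<open>H\<close> is \<open>h\<close>,
  and the bound \<open>E exp (\<theta> H) \<le> exp ((exp \<theta> - 1) h)\<close> follows from \<open>1 + t \<le> exp t\<close>.

  (I) Taking \<open>\<theta> = 1 / sqrt h\<close> and \<open>\<theta> = - 1 / sqrt h\<close> bounds
  \<open>E exp (\<bar>H - h\<bar> / sqrt h)\<close> by a constant, so \<open>E \<bar>H/h - 1\<bar> powr p\<close> is of order
  \<open>h powr (- p/2)\<close>. It remains that \<open>h\<close> tends to infinity: survival forces at least half of the steps
  to be up-steps, and in fact \<open>exp h \<ge> (n + 4) / 4\<close> (\<open>exp_h_plus_ge\<close>).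

  (II) The tree is at least as high as any of its active vertices, so (I) gives the lower bound.
  For the upper bound, frozen vertices count too. Each vertex was attached, at its birth, to a
  uniform active vertex of an earlier tree, so the expected sum of \<open>exp (\<theta> * height)\<close> over all
  vertices is at most \<open>(1 + n exp \<theta>) exp ((exp \<theta> - 1) h)\<close>. At \<open>\<theta> = 1\<close> the probability of a height
  above \<open>(e + \<epsilon>) h\<close> is at most of order \<open>n exp (- (1 + \<epsilon>) h)\<close>, and the factor \<open>n\<close> is absorbed
  by \<open>exp h\<close>, whence the constant \<open>e\<close>.

  (III) The same exponential moment is used with a small \<open>\<theta>\<close>. With \<open>b = ln n + 2\<close> the factor
  \<open>1 + n exp \<theta>\<close> is at most \<open>exp b\<close>, and \<open>\<theta> = sqrt (b / h)\<close> balances it against the second-order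
  term \<open>\<theta>\<^sup>2 h\<close>. The excess of the height over \<open>h\<close> is then of order \<open>b / \<theta> = sqrt (b h)\<close>, which
  is small compared with \<open>h\<close> as soon as \<open>ln n / h\<close> tends to zero.

  Every law here has finite support, so all expectations are finite sums.
\<close>

section \<open>Growing a tree by one leaf\<close>

text \<open>
  The invariant of the construction. The bound on the names of the vertices makes the vertex named
  \<open>n + 1\<close> new at the next step. Reachability matters because the distance between vertices that
  no path joins is the least element of an empty set, of which nothing is known.
\<close>

definition connected_tree :: "nat \<Rightarrow> ltree \<Rightarrow> bool" where
  "connected_tree n T \<longleftrightarrow>
     root_vertex T = 0 \<and> 0 \<in> vertices T \<and> vertices T \<subseteq> {..n}
     \<and> (\<forall>e\<in>dom (edge_label T). e \<subseteq> vertices T)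
     \<and> (\<forall>v\<in>vertices T. \<exists>k. (0, v) \<in> adjacency T ^^ k)"

lemma active_vertices_subset: "active_vertices T \<subseteq> vertices T"
  by (auto simp: active_vertices_def vertices_def)

lemma connected_tree_finite:
  assumes "connected_tree n T"
  shows "finite (vertices T)" "finite (active_vertices T)"
proof -
  show "finite (vertices T)"
    using assms by (auto simp: connected_tree_def intro: finite_subset)
  then show "finite (active_vertices T)"
    using active_vertices_subset by (rule finite_subset[rotated])
qed

lemma vertices_initial_tree: "vertices initial_tree = {0}"
  by (auto simp: vertices_def initial_tree_def)

lemma active_vertices_initial_tree: "active_vertices initial_tree = {0}"
  by (auto simp: active_vertices_def initial_tree_def)

lemma vertex_height_initial_tree: "vertex_height initial_tree 0 = 0"
  unfolding vertex_height_def graph_distance_def by (rule Least_eq_0) (simp add: initial_tree_def)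

lemma connected_tree_initial_tree: "connected_tree 0 initial_tree"
proof -
  have "(0, 0) \<in> adjacency initial_tree ^^ 0" by simp
  then show ?thesis
    unfolding connected_tree_def vertices_initial_tree
    by (auto simp: initial_tree_def intro: exI[of _ 0])
qed

lemma adjacency_attach:
  "adjacency (attach n v T) = adjacency T \<union> {(v, n), (n, v)}"
  by (auto simp: adjacency_def attach_def doubleton_eq_iff)

lemma vertices_attach: "vertices (attach n v T) = insert n (vertices T)"
  by (auto simp: vertices_def attach_def)

lemma active_vertices_attach: "active_vertices (attach n v T) = insert n (active_vertices T)"
  by (auto simp: active_vertices_def attach_def)

lemma relpow_mono: "R \<subseteq> S \<Longrightarrow> R ^^ k \<subseteq> S ^^ k" for R S :: "('a \<times> 'a) set"
  by (induction k) auto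

text \<open>
  A path cannot gain from a detour through a leaf: it must return to the neighbour of the leaf
  from which it came. Both cases are needed in one induction, since a path to an old vertex may visit
  the leaf on its way.
\<close>

lemma relpow_attach_leaf:
  assumes "(r, u) \<in> (R \<union> {(v, n), (n, v)}) ^^ k"
    and "n \<notin> Field R" "v \<noteq> n" "r \<noteq> n"
  shows "if u = n then \<exists>j<k. (r, v) \<in> R ^^ j else \<exists>j\<le>k. (r, u) \<in> R ^^ j"
  using assms(1)
proof (induction k arbitrary: u)
  case 0
  then show ?case using assms by auto
next
  case (Suc k)
  then obtain w where w: "(r, w) \<in> (R \<union> {(v, n), (n, v)}) ^^ k"
    and wu: "(w, u) \<in> R \<union> {(v, n), (n, v)}" by auto
  note IH = Suc.IH[OF w]
  consider "(w, u) \<in> R" "w \<noteq> n" "u \<noteq> n" | "w = v" "u = n" | "w = n" "u = v"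
    using wu assms(2) by (auto simp: Field_def)
  then show ?case
  proof cases
    case 1
    then obtain j where "j \<le> k" "(r, w) \<in> R ^^ j" using IH by auto
    then have "(r, u) \<in> R ^^ Suc j" "Suc j \<le> Suc k" using 1 by auto
    then show ?thesis using 1 by (metis)
  next
    case 2
    then show ?thesis using IH assms(3) by (auto simp: less_Suc_eq_le)
  next
    case 3
    then show ?thesis using IH assms(3) by (auto intro: less_imp_le less_SucI)
  qed
qed

context
  fixes m n v T
  assumes T: "connected_tree m T" and n: "n \<notin> vertices T" and v: "v \<in> vertices T"
begin

lemma Field_adjacency: "Field (adjacency T) \<subseteq> vertices T"
proof
  fix w assume "w \<in> Field (adjacency T)"
  then obtain u where "{w, u} \<in> dom (edge_label T)"
    unfolding Field_def adjacency_def by (force simp: insert_commute)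
  then have "{w, u} \<subseteq> vertices T" using T unfolding connected_tree_def by blast
  then show "w \<in> vertices T" by simp
qed

lemma root_vertex_attach: "root_vertex (attach n v T) = 0"
  using T by (auto simp: connected_tree_def attach_def)

lemma leaf_not_in_tree: "n \<notin> Field (adjacency T)" "v \<noteq> n" "0 \<noteq> n"
  using T n v Field_adjacency by (auto simp: connected_tree_def)

lemma vertex_height_attach_old:
  assumes "w \<in> vertices T"
  shows "vertex_height (attach n v T) w = vertex_height T w"
proof -
  let ?R = "adjacency T" and ?R' = "adjacency (attach n v T)"
  obtain k where "(0, w) \<in> ?R ^^ k" using T assms by (auto simp: connected_tree_def)
  then have L: "(0, w) \<in> ?R ^^ (LEAST k. (0, w) \<in> ?R ^^ k)" by (rule LeastI)
  have sub: "?R ^^ k \<subseteq> ?R' ^^ k" for k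
    by (rule relpow_mono) (auto simp: adjacency_attach)
  have "(LEAST k. (0, w) \<in> ?R' ^^ k) = (LEAST k. (0, w) \<in> ?R ^^ k)"
  proof (rule Least_equality)
    show "(0, w) \<in> ?R' ^^ (LEAST k. (0, w) \<in> ?R ^^ k)" using L sub by blast
  next
    fix k assume "(0, w) \<in> ?R' ^^ k"
    then obtain j where "j \<le> k" "(0, w) \<in> ?R ^^ j"
      using relpow_attach_leaf[where r=0 and u=w and R="?R" and v=v and n=n and k=k] leaf_not_in_tree assms n
      by (auto simp: adjacency_attach split: if_splits)
    then show "(LEAST k. (0, w) \<in> ?R ^^ k) \<le> k" by (meson Least_le order_trans)
  qed
  then show ?thesis
    using T root_vertex_attach by (simp add: vertex_height_def graph_distance_def connected_tree_def)
qed

lemma vertex_height_attach_new: "vertex_height (attach n v T) n = Suc (vertex_height T v)"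
proof -
  let ?R = "adjacency T" and ?R' = "adjacency (attach n v T)"
  obtain k where "(0, v) \<in> ?R ^^ k" using T v by (auto simp: connected_tree_def)
  then have L: "(0, v) \<in> ?R ^^ (LEAST k. (0, v) \<in> ?R ^^ k)" by (rule LeastI)
  have sub: "?R ^^ k \<subseteq> ?R' ^^ k" for k
    by (rule relpow_mono) (auto simp: adjacency_attach)
  have "(LEAST k. (0, n) \<in> ?R' ^^ k) = Suc (LEAST k. (0, v) \<in> ?R ^^ k)"
  proof (rule Least_equality)
    have "(v, n) \<in> ?R'" by (simp add: adjacency_attach)
    then show "(0, n) \<in> ?R' ^^ Suc (LEAST k. (0, v) \<in> ?R ^^ k)" using L sub by auto
  next
    fix k assume "(0, n) \<in> ?R' ^^ k"
    then obtain j where "j < k" "(0, v) \<in> ?R ^^ j"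
      using relpow_attach_leaf[where r=0 and u=n and R="?R" and v=v and n=n and k=k] leaf_not_in_tree
      by (auto simp: adjacency_attach)
    then show "Suc (LEAST k. (0, v) \<in> ?R ^^ k) \<le> k"
      by (meson Least_le Suc_le_eq order_le_less_trans)
  qed
  then show ?thesis
    using T root_vertex_attach by (simp add: vertex_height_def graph_distance_def connected_tree_def)
qed

lemma connected_tree_attach:
  assumes "m < n"
  shows "connected_tree n (attach n v T)"
proof -
  have sub: "adjacency T ^^ k \<subseteq> adjacency (attach n v T) ^^ k" for k
    by (rule relpow_mono) (auto simp: adjacency_attach)
  obtain k where "(0, v) \<in> adjacency T ^^ k" using T v by (auto simp: connected_tree_def)
  moreover have "(v, n) \<in> adjacency (attach n v T)" by (simp add: adjacency_attach)
  ultimately have "(0, n) \<in> adjacency (attach n v T) ^^ Suc k" using sub by auto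
  moreover have "\<forall>w\<in>vertices T. \<exists>k. (0, w) \<in> adjacency (attach n v T) ^^ k"
    using T sub unfolding connected_tree_def by blast
  ultimately have reach: "\<forall>w\<in>vertices (attach n v T). \<exists>k. (0, w) \<in> adjacency (attach n v T) ^^ k"
    unfolding vertices_attach by blast
  have "\<forall>e\<in>dom (edge_label (attach n v T)). e \<subseteq> vertices (attach n v T)"
    unfolding vertices_attach using T v by (auto simp: connected_tree_def attach_def)
  moreover have "vertices (attach n v T) \<subseteq> {..n}" "0 \<in> vertices (attach n v T)"
    unfolding vertices_attach using T assms by (force simp: connected_tree_def)+
  ultimately show ?thesis
    using reach root_vertex_attach by (simp add: connected_tree_def)
qed

end

lemma vertices_freeze: "v \<in> vertices T \<Longrightarrow> vertices (freeze n v T) = vertices T"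
  by (auto simp: vertices_def freeze_def)

lemma active_vertices_freeze: "active_vertices (freeze n v T) = active_vertices T - {v}"
  by (auto simp: active_vertices_def freeze_def)

lemma vertex_height_freeze: "vertex_height (freeze n v T) = vertex_height T"
  by (simp add: fun_eq_iff vertex_height_def graph_distance_def adjacency_def freeze_def)

lemma connected_tree_freeze:
  assumes "connected_tree m T" "v \<in> vertices T" "m \<le> n"
  shows "connected_tree n (freeze k v T)"
proof -
  have "adjacency (freeze k v T) = adjacency T" "edge_label (freeze k v T) = edge_label T"
    "root_vertex (freeze k v T) = root_vertex T"
    by (auto simp: adjacency_def freeze_def)
  then show ?thesis
    using assms vertices_freeze[OF assms(2)] by (force simp: connected_tree_def)
qed

section \<open>The generating function of the heights in a tree\<close>

definition height_gf :: "real \<Rightarrow> ltree \<Rightarrow> nat set \<Rightarrow> real" where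
  "height_gf z T A = (\<Sum>v\<in>A. z ^ vertex_height T v)"

lemma height_gf_attach:
  assumes T: "connected_tree m T" and n: "n \<notin> vertices T" and v: "v \<in> vertices T"
    and A: "A \<subseteq> vertices T"
  shows "height_gf z (attach n v T) (insert n A) = height_gf z T A + z * z ^ vertex_height T v"
proof -
  have "finite A" "n \<notin> A" using connected_tree_finite[OF T] A n finite_subset by auto
  then have "height_gf z (attach n v T) (insert n A)
      = z ^ vertex_height (attach n v T) n + (\<Sum>w\<in>A. z ^ vertex_height (attach n v T) w)"
    by (simp add: height_gf_def)
  also have "(\<Sum>w\<in>A. z ^ vertex_height (attach n v T) w) = height_gf z T A"
    unfolding height_gf_def using A vertex_height_attach_old[OF T n v] by (intro sum.cong) auto
  finally show ?thesis using vertex_height_attach_new[OF T n v] by simp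
qed

lemma vertex_height_le_tree_height:
  assumes "connected_tree n T" "u \<in> vertices T"
  shows "vertex_height T u \<le> tree_height T"
  unfolding tree_height_def using connected_tree_finite[OF assms(1)] assms(2) by (intro Max_ge) auto

lemma power_tree_height_le_gf:
  assumes T: "connected_tree n T" and z: "0 \<le> z"
  shows "z ^ tree_height T \<le> height_gf z T (vertices T)"
proof -
  note fin = connected_tree_finite(1)[OF T]
  have "vertices T \<noteq> {}" using T by (auto simp: connected_tree_def)
  then have "tree_height T \<in> vertex_height T ` vertices T"
    unfolding tree_height_def using fin by (intro Max_in) auto
  then obtain v where "v \<in> vertices T" "tree_height T = vertex_height T v" by auto
  then show ?thesis
    unfolding height_gf_def using fin z by (auto intro!: member_le_sum)
qed

section \<open>Powers against exponentials\<close>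

text \<open>
  Raise \<open>t / p \<le> exp (t / p)\<close> to the power \<open>p\<close>.
\<close>

lemma powr_le_exp:
  fixes t p :: real
  assumes "0 \<le> t" "1 \<le> p"
  shows "t powr p \<le> p powr p * exp t"
proof -
  have "t / p \<le> exp (t / p)" using exp_ge_add_one_self[of "t / p"] by linarith
  then have "t \<le> p * exp (t / p)" using assms by (simp add: field_simps)
  then have "t powr p \<le> (p * exp (t / p)) powr p" using assms by (intro powr_mono2) auto
  also have "\<dots> = p powr p * exp t" using assms by (simp add: powr_mult exp_powr_real)
  finally show ?thesis .
qed

text \<open>
  Compares moments with an exponential whose expectation is controlled only after a shift by a
  large \<open>a\<close>: below \<open>a\<close> the left-hand side is at most one, and above \<open>a\<close> the excess \<open>y - a\<close>
  dominates \<open>y / a - 1\<close>.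
\<close>

lemma powr_max_le_exp:
  fixes a p y :: real
  assumes "1 \<le> a" "1 \<le> p"
  shows "max 0 (y / a) powr p \<le> 1 + p powr p * exp 1 * exp (y - a)"
proof (cases "y \<le> a")
  case True
  then have "max 0 (y / a) powr p \<le> 1 powr p" using assms by (intro powr_mono2) auto
  moreover have "0 \<le> p powr p * exp 1 * exp (y - a)" by simp
  ultimately show ?thesis by (simp add: add.commute add_increasing2)
next
  case False
  have "1 * (y - a) \<le> a * (y - a)" using False assms by (intro mult_right_mono) auto
  then have "y / a \<le> 1 + (y - a)" using assms by (simp add: field_simps)
  then have "max 0 (y / a) powr p \<le> (1 + (y - a)) powr p"
    using False assms by (intro powr_mono2) auto
  also have "\<dots> \<le> p powr p * exp (1 + (y - a))" using False assms by (intro powr_le_exp) auto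
  finally show ?thesis unfolding exp_add by (simp add: mult.assoc)
qed

section \<open>Expectations under finitely supported laws\<close>

lemma expectation_bind_finite:
  fixes h :: "'b \<Rightarrow> real"
  assumes "finite (set_pmf p)" "\<And>a. a \<in> set_pmf p \<Longrightarrow> finite (set_pmf (f a))"
  shows "measure_pmf.expectation (bind_pmf p f) h
    = measure_pmf.expectation p (\<lambda>a. measure_pmf.expectation (f a) h)"
proof -
  have "measure_pmf.expectation (bind_pmf p f) h
      = (\<Sum>a\<in>set_pmf p. pmf p a *\<^sub>R measure_pmf.expectation (f a) h)"
    using assms by (intro pmf_expectation_bind) auto
  also have "\<dots> = measure_pmf.expectation p (\<lambda>a. measure_pmf.expectation (f a) h)"
    using assms(1) by (intro integral_measure_pmf[symmetric]) auto
  finally show ?thesis .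
qed

lemma expectation_mono_finite:
  fixes f g :: "'a \<Rightarrow> real"
  assumes "finite (set_pmf p)" "\<And>a. a \<in> set_pmf p \<Longrightarrow> f a \<le> g a"
  shows "measure_pmf.expectation p f \<le> measure_pmf.expectation p g"
  using assms by (intro integral_mono_AE integrable_measure_pmf_finite) (auto simp: AE_measure_pmf_iff)

lemma expectation_cong_support:
  fixes f g :: "'a \<Rightarrow> real"
  assumes "\<And>a. a \<in> set_pmf p \<Longrightarrow> f a = g a"
  shows "measure_pmf.expectation p f = measure_pmf.expectation p g"
  using assms by (intro integral_cong_AE) (auto simp: AE_measure_pmf_iff)

lemma prob_le_expectation:
  fixes f :: "'a \<Rightarrow> real"
  assumes "finite (set_pmf p)" "\<And>a. a \<in> set_pmf p \<Longrightarrow> 0 \<le> f a"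
    "\<And>a. a \<in> set_pmf p \<Longrightarrow> a \<in> A \<Longrightarrow> 1 \<le> f a"
  shows "measure_pmf.prob p A \<le> measure_pmf.expectation p f"
proof -
  have "measure_pmf.prob p A = measure_pmf.expectation p (indicator A)" by simp
  also have "\<dots> \<le> measure_pmf.expectation p f"
    using assms by (intro expectation_mono_finite) (auto simp: indicator_def)
  finally show ?thesis .
qed

section \<open>Survival forces up-steps\<close>

lemma walk_0 [simp]: "walk x 0 = 1"
  by (simp add: walk_def)

lemma walk_Suc: "walk x (Suc n) = walk x n + x (Suc n)"
  by (simp add: walk_def)

lemma h_plus_0 [simp]: "h_plus x 0 = 0"
  by (simp add: h_plus_def)

lemma h_plus_Suc:
  "h_plus x (Suc n) = h_plus x n + (if x (Suc n) = 1 then 1 / walk x (Suc n) else 0)"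
  by (simp add: h_plus_def)

locale surviving_signs =
  fixes x :: "nat \<Rightarrow> int" and n :: nat
  assumes signs: "\<And>i. 1 \<le> i \<Longrightarrow> x i \<in> {-1, 1}"
    and survival: "enat n < hitting_time x"
begin

lemma sign_Suc: "x (Suc k) = -1 \<or> x (Suc k) = 1"
  using signs[of "Suc k"] by auto

lemma walk_pos: "k \<le> n \<Longrightarrow> walk x k \<ge> 1"
proof (induction k)
  case (Suc k)
  have "walk x (Suc k) \<noteq> 0"
  proof
    assume "walk x (Suc k) = 0"
    then have "hitting_time x \<le> enat (Suc k)"
      unfolding hitting_time_def by (intro Inf_lower) auto
    also have "\<dots> \<le> enat n" using Suc by simp
    finally show False using survival by simp
  qed
  then show ?case using Suc sign_Suc[of k] by (auto simp: walk_Suc)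
qed simp

lemma walk_le: "walk x k \<le> int k + 1"
proof (induction k)
  case (Suc k)
  then show ?case using sign_Suc[of k] by (auto simp: walk_Suc)
qed simp

lemma h_plus_mono: "k \<le> l \<Longrightarrow> l \<le> n \<Longrightarrow> h_plus x k \<le> h_plus x l"
proof (induction l rule: dec_induct)
  case (step l)
  then have "h_plus x k \<le> h_plus x l" by simp
  also have "\<dots> \<le> h_plus x (Suc l)" using step.prems walk_pos[of "Suc l"] by (simp add: h_plus_Suc)
  finally show ?case .
qed simp

text \<open>
  This form makes the induction work. A down-step leaves the sum \<open>walk x k + k\<close> unchanged.
  With \<open>w = walk x k\<close>, an up-step raises the right-hand side by \<open>1/2\<close> and multiplies the left-hand
  side by at least \<open>1 + 1 / (w + 1)\<close>; this gains \<open>1/2\<close> because the left-hand side was at least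
  \<open>(w + k + 3) / 4\<close>, and \<open>(w + k + 3) / 4 \<ge> (w + 1) / 2\<close> as \<open>w \<le> k + 1\<close>.
  Equivalently, \<open>h_plus\<close> dominates the harmonic sum over the number of up-steps.
\<close>

lemma exp_h_plus_ge_walk: "k \<le> n \<Longrightarrow> exp (h_plus x k) \<ge> (walk x k + k + 3) / 4"
proof (induction k)
  case (Suc k)
  let ?w = "real_of_int (walk x k)"
  have IH: "exp (h_plus x k) \<ge> (?w + k + 3) / 4" and w: "?w \<ge> 1" "?w \<le> k + 1"
    using Suc walk_pos[of k] walk_le[of k] by auto
  show ?case
  proof (cases "x (Suc k) = 1")
    case True
    have "(walk x (Suc k) + Suc k + 3) / 4 = (?w + k + 3) / 4 + 1 / 2"
      using True by (simp add: walk_Suc field_simps)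
    also have "1 / 2 \<le> (?w + k + 3) / 4 * (1 / (?w + 1))" using w by (simp add: field_simps)
    also have "(?w + k + 3) / 4 + (?w + k + 3) / 4 * (1 / (?w + 1))
        = (?w + k + 3) / 4 * (1 + 1 / (?w + 1))" by (simp only: distrib_left mult_1_right)
    also have "\<dots> \<le> exp (h_plus x k) * exp (1 / (?w + 1))"
      using IH w exp_ge_add_one_self[of "1 / (?w + 1)"] by (intro mult_mono) auto
    also have "\<dots> = exp (h_plus x (Suc k))"
      using True by (simp add: h_plus_Suc walk_Suc exp_add)
    finally show ?thesis by simp
  next
    case False
    then show ?thesis using IH sign_Suc[of k] by (simp add: h_plus_Suc walk_Suc)
  qed
qed simp

lemma exp_h_plus_ge: "(real n + 4) / 4 \<le> exp (h_plus x n)"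
  using exp_h_plus_ge_walk[of n] walk_pos[of n] by simp

section \<open>The law of the heights\<close>

lemma uaf_support:
  assumes "k \<le> n" "T \<in> set_pmf (uaf x k)"
  shows "connected_tree k T \<and> int (card (active_vertices T)) = walk x k"
  using assms
proof (induction k arbitrary: T)
  case 0
  then show ?case by (simp add: connected_tree_initial_tree active_vertices_initial_tree)
next
  case (Suc k)
  then obtain T' where T': "T' \<in> set_pmf (uaf x k)"
    and T: "T \<in> set_pmf (if active_vertices T' = {} then return_pmf T' else map_pmf
       (\<lambda>v. if x (Suc k) = -1 then freeze (Suc k) v T' else attach (Suc k) v T')
       (pmf_of_set (active_vertices T')))" by auto
  have IH: "connected_tree k T'" "int (card (active_vertices T')) = walk x k"
    using Suc T' by auto
  note fin = connected_tree_finite[OF IH(1)]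
  have ne: "active_vertices T' \<noteq> {}" using IH walk_pos[of k] Suc.prems by auto
  then have "T \<in> (\<lambda>v. if x (Suc k) = -1 then freeze (Suc k) v T' else attach (Suc k) v T')
      ` active_vertices T'"
    using T fin by simp
  then obtain v where v: "v \<in> active_vertices T'"
    and Tv: "T = (if x (Suc k) = -1 then freeze (Suc k) v T' else attach (Suc k) v T')"
    by blast
  have vv: "v \<in> vertices T'" using v active_vertices_subset by blast
  have new: "Suc k \<notin> vertices T'" using IH(1) by (auto simp: connected_tree_def)
  show ?case
  proof (cases "x (Suc k) = -1")
    case True
    have "card (active_vertices T' - {v}) = card (active_vertices T') - 1"
      using v by (rule card_Diff_singleton)
    moreover have "card (active_vertices T') \<ge> 1"
      using ne fin by (simp add: Suc_le_eq card_gt_0_iff)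
    ultimately show ?thesis
      using True Tv IH connected_tree_freeze[OF IH(1) vv, of "Suc k" "Suc k"]
      by (auto simp: active_vertices_freeze walk_Suc of_nat_diff)
  next
    case False
    have "Suc k \<notin> active_vertices T'" using new active_vertices_subset by blast
    then show ?thesis
      using False Tv IH sign_Suc[of k] fin connected_tree_attach[OF IH(1) new vv]
        active_vertices_attach
      by (auto simp: walk_Suc)
  qed
qed

lemma uaf_active_nonempty:
  assumes "k \<le> n" "T \<in> set_pmf (uaf x k)"
  shows "connected_tree k T" "finite (active_vertices T)" "active_vertices T \<noteq> {}"
    "real (card (active_vertices T)) = walk x k"
proof -
  show c: "connected_tree k T" using uaf_support[OF assms] by simp
  then show "finite (active_vertices T)" by (rule connected_tree_finite)
  show "active_vertices T \<noteq> {}" using uaf_support[OF assms] walk_pos[OF assms(1)] by auto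
  show "real (card (active_vertices T)) = walk x k"
    using uaf_support[OF assms] by (metis of_int_of_nat_eq)
qed

lemma finite_set_pmf_uaf: "k \<le> n \<Longrightarrow> finite (set_pmf (uaf x k))"
proof (induction k)
  case (Suc k)
  then show ?case using uaf_active_nonempty[of k] by auto
qed simp

lemma finite_set_pmf_uaf_active: "finite (set_pmf (uaf_active x n))"
  unfolding uaf_active_def using finite_set_pmf_uaf[of n] uaf_active_nonempty[of n] by auto

lemma expectation_uaf_Suc:
  fixes F :: "ltree \<Rightarrow> real"
  assumes "Suc k \<le> n"
  shows "measure_pmf.expectation (uaf x (Suc k)) F
    = measure_pmf.expectation (uaf x k) (\<lambda>T.
        (\<Sum>v\<in>active_vertices T.
           F (if x (Suc k) = -1 then freeze (Suc k) v T else attach (Suc k) v T)) / walk x k)"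
proof -
  have k: "k \<le> n" using assms by simp
  note ne = uaf_active_nonempty[OF k]
  show ?thesis
    unfolding uaf.simps
    apply (subst expectation_bind_finite)
    subgoal using finite_set_pmf_uaf[OF k] .
    subgoal using ne by auto
    apply (rule expectation_cong_support)
    using ne by (simp add: integral_pmf_of_set)
qed

text \<open>
  The product is the generating function of a sum of independent Bernoulli variables of parameters
  \<open>1 / walk x i\<close>, and the factor \<open>walk x k\<close> is the number of active vertices. Averaging over the
  vertex chosen at the next step multiplies the sum by \<open>1 - 1/w\<close> when it is frozen and by \<open>1 + z/w\<close>
  when it receives a child, where \<open>w = walk x k\<close>; dividing by the new number of active vertices
  gives the factors \<open>1\<close> and \<open>1 + (z - 1)/(w + 1)\<close>.
\<close>

lemma expectation_active_gf:
  "k \<le> n \<Longrightarrow> measure_pmf.expectation (uaf x k) (\<lambda>T. height_gf z T (active_vertices T))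
    = walk x k * (\<Prod>i | i \<in> {1..k} \<and> x i = 1. 1 + (z - 1) / walk x i)"
proof (induction k)
  case 0
  show ?case
    by (simp add: height_gf_def active_vertices_initial_tree vertex_height_initial_tree)
next
  case (Suc k)
  let ?m = "measure_pmf.expectation (uaf x k) (\<lambda>T. height_gf z T (active_vertices T))"
  let ?P = "\<lambda>k. \<Prod>i | i \<in> {1..k} \<and> x i = 1. 1 + (z - 1) / walk x i"
  have k: "k \<le> n" using Suc.prems by simp
  note ne = uaf_active_nonempty[OF k]
  have w: "real_of_int (walk x k) \<ge> 1" using walk_pos[OF k] by simp
  show ?case
  proof (cases "x (Suc k) = -1")
    case True
    have "measure_pmf.expectation (uaf x (Suc k)) (\<lambda>T. height_gf z T (active_vertices T))
      = measure_pmf.expectation (uaf x k)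
          (\<lambda>T. (1 - 1 / walk x k) * height_gf z T (active_vertices T))"
      unfolding expectation_uaf_Suc[OF Suc.prems]
    proof (rule expectation_cong_support)
      fix T assume T: "T \<in> set_pmf (uaf x k)"
      have "(\<Sum>v\<in>active_vertices T. height_gf z (freeze (Suc k) v T) (active_vertices (freeze (Suc k) v T)))
          = (\<Sum>v\<in>active_vertices T. height_gf z T (active_vertices T) - z ^ vertex_height T v)"
        using ne(2)[OF T] by (intro sum.cong)
          (auto simp: height_gf_def active_vertices_freeze vertex_height_freeze sum_diff1)
      also have "\<dots> = (walk x k - 1) * height_gf z T (active_vertices T)"
        using ne(4)[OF T] by (simp add: sum_subtractf height_gf_def algebra_simps)
      finally show "(\<Sum>v\<in>active_vertices T. height_gf z
             (if x (Suc k) = - 1 then freeze (Suc k) v T else attach (Suc k) v T)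
             (active_vertices (if x (Suc k) = - 1 then freeze (Suc k) v T else attach (Suc k) v T))) /
          walk x k = (1 - 1 / walk x k) * height_gf z T (active_vertices T)"
        using True w by (simp add: field_simps)
    qed
    also have "\<dots> = (1 - 1 / walk x k) * ?m" by simp
    also have "\<dots> = (walk x k - 1) * ?P k" using Suc.IH[OF k] w by (simp add: field_simps)
    also have "?P k = ?P (Suc k)"
    proof (rule prod.cong)
      show "{i \<in> {1..k}. x i = 1} = {i \<in> {1..Suc k}. x i = 1}"
        using True by (auto simp: le_Suc_eq)
    qed simp
    finally show ?thesis using True by (simp add: walk_Suc)
  next
    case False
    then have x1: "x (Suc k) = 1" using sign_Suc[of k] by simp
    have "measure_pmf.expectation (uaf x (Suc k)) (\<lambda>T. height_gf z T (active_vertices T))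
      = measure_pmf.expectation (uaf x k)
          (\<lambda>T. (1 + z / walk x k) * height_gf z T (active_vertices T))"
      unfolding expectation_uaf_Suc[OF Suc.prems]
    proof (rule expectation_cong_support)
      fix T assume T: "T \<in> set_pmf (uaf x k)"
      have new: "Suc k \<notin> vertices T" using ne(1)[OF T] by (auto simp: connected_tree_def)
      have "(\<Sum>v\<in>active_vertices T. height_gf z (attach (Suc k) v T) (active_vertices (attach (Suc k) v T)))
          = (\<Sum>v\<in>active_vertices T. height_gf z T (active_vertices T) + z * z ^ vertex_height T v)"
      proof (rule sum.cong[OF refl])
        fix v assume "v \<in> active_vertices T"
        then have v: "v \<in> vertices T" using active_vertices_subset by blast
        show "height_gf z (attach (Suc k) v T) (active_vertices (attach (Suc k) v T))
          = height_gf z T (active_vertices T) + z * z ^ vertex_height T v"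
          unfolding active_vertices_attach
          by (rule height_gf_attach[OF ne(1)[OF T] new v active_vertices_subset])
      qed
      also have "\<dots> = (walk x k + z) * height_gf z T (active_vertices T)"
        using ne(4)[OF T] by (simp add: sum.distrib height_gf_def sum_distrib_left algebra_simps)
      finally show "(\<Sum>v\<in>active_vertices T. height_gf z
             (if x (Suc k) = - 1 then freeze (Suc k) v T else attach (Suc k) v T)
             (active_vertices (if x (Suc k) = - 1 then freeze (Suc k) v T else attach (Suc k) v T))) /
          walk x k = (1 + z / walk x k) * height_gf z T (active_vertices T)"
        using x1 w by (simp add: field_simps)
    qed
    also have "\<dots> = (1 + z / walk x k) * ?m" by simp
    also have "\<dots> = (walk x k + z) * ?P k" using Suc.IH[OF k] w by (simp add: field_simps)
    also have "walk x k + z = walk x (Suc k) * (1 + (z - 1) / walk x (Suc k))"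
      using x1 w by (simp add: walk_Suc field_simps)
    also have "\<dots> * ?P k = walk x (Suc k) * ?P (Suc k)"
    proof -
      have "{i \<in> {1..Suc k}. x i = 1} = insert (Suc k) {i \<in> {1..k}. x i = 1}"
        using x1 by (auto simp: le_Suc_eq)
      then show ?thesis by simp
    qed
    finally show ?thesis .
  qed
qed

lemma expectation_active_gf_le:
  assumes "k \<le> n" "0 \<le> z"
  shows "measure_pmf.expectation (uaf x k) (\<lambda>T. height_gf z T (active_vertices T))
    \<le> walk x k * exp ((z - 1) * h_plus x k)"
proof -
  have "(\<Prod>i | i \<in> {1..k} \<and> x i = 1. 1 + (z - 1) / walk x i)
      \<le> (\<Prod>i | i \<in> {1..k} \<and> x i = 1. exp ((z - 1) * (1 / walk x i)))"
  proof (intro prod_mono conjI)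
    fix i assume "i \<in> {i \<in> {1..k}. x i = 1}"
    then have w: "real_of_int (walk x i) \<ge> 1" using walk_pos[of i] assms by auto
    then have "1 / walk x i \<le> (1::real)" by simp
    moreover have "z / walk x i \<ge> 0" using w assms by simp
    ultimately show "0 \<le> 1 + (z - 1) / walk x i" by (simp add: diff_divide_distrib)
    show "1 + (z - 1) / walk x i \<le> exp ((z - 1) * (1 / walk x i))"
      using exp_ge_add_one_self[of "(z - 1) / walk x i"] by simp
  qed
  also have "\<dots> = exp (\<Sum>i | i \<in> {1..k} \<and> x i = 1. (z - 1) * (1 / walk x i))"
    by (rule exp_sum[symmetric]) simp
  also have "(\<Sum>i | i \<in> {1..k} \<and> x i = 1. (z - 1) * (1 / walk x i)) = (z - 1) * h_plus x k"
    unfolding h_plus_def sum_distrib_left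
    by (intro sum.mono_neutral_cong_left) (auto simp: indicator_def)
  finally show ?thesis
    unfolding expectation_active_gf[OF assms(1)] using walk_pos[OF assms(1)]
    by (intro mult_left_mono) auto
qed

text \<open>
  The frozen vertices have to be counted here. An up-step adds a vertex whose height is one more
  than that of a uniform active vertex, so the sum grows by \<open>z\<close> times a quantity bounded in
  \<open>expectation_active_gf_le\<close>; a down-step adds nothing. As \<open>z \<ge> 1\<close>, the bounds at earlier times
  are all dominated by the one at the final time.
\<close>

lemma expectation_vertices_gf_le:
  assumes "k \<le> n" "1 \<le> z"
  shows "measure_pmf.expectation (uaf x k) (\<lambda>T. height_gf z T (vertices T))
    \<le> 1 + k * z * exp ((z - 1) * h_plus x n)"
  using assms(1)
proof (induction k)
  case 0
  show ?case by (simp add: height_gf_def vertices_initial_tree vertex_height_initial_tree)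
next
  case (Suc k)
  let ?G = "\<lambda>k. measure_pmf.expectation (uaf x k) (\<lambda>T. height_gf z T (vertices T))"
  have k: "k \<le> n" using Suc.prems by simp
  note ne = uaf_active_nonempty[OF k]
  have w: "real_of_int (walk x k) \<ge> 1" using walk_pos[OF k] by simp
  have int: "integrable (measure_pmf (uaf x k)) f" for f :: "ltree \<Rightarrow> real"
    using finite_set_pmf_uaf[OF k] by (rule integrable_measure_pmf_finite)
  have "?G (Suc k) \<le> measure_pmf.expectation (uaf x k) (\<lambda>T. height_gf z T (vertices T)
      + z / walk x k * height_gf z T (active_vertices T))"
    unfolding expectation_uaf_Suc[OF Suc.prems]
  proof (rule expectation_mono_finite[OF finite_set_pmf_uaf[OF k]])
    fix T assume T: "T \<in> set_pmf (uaf x k)"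
    have new: "Suc k \<notin> vertices T" using ne(1)[OF T] by (auto simp: connected_tree_def)
    have "(\<Sum>v\<in>active_vertices T. height_gf z
             (if x (Suc k) = - 1 then freeze (Suc k) v T else attach (Suc k) v T)
             (vertices (if x (Suc k) = - 1 then freeze (Suc k) v T else attach (Suc k) v T)))
        \<le> (\<Sum>v\<in>active_vertices T. height_gf z T (vertices T) + z * z ^ vertex_height T v)"
    proof (rule sum_mono)
      fix v assume "v \<in> active_vertices T"
      then have v: "v \<in> vertices T" using active_vertices_subset by blast
      have "height_gf z (freeze (Suc k) v T) (vertices (freeze (Suc k) v T)) = height_gf z T (vertices T)"
        unfolding vertices_freeze[OF v] by (simp add: height_gf_def vertex_height_freeze)
      moreover have "height_gf z (attach (Suc k) v T) (vertices (attach (Suc k) v T))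
          = height_gf z T (vertices T) + z * z ^ vertex_height T v"
        unfolding vertices_attach
        by (rule height_gf_attach[OF ne(1)[OF T] new v order_refl])
      moreover have "0 \<le> z * z ^ vertex_height T v" using assms by simp
      ultimately show "height_gf z
             (if x (Suc k) = - 1 then freeze (Suc k) v T else attach (Suc k) v T)
             (vertices (if x (Suc k) = - 1 then freeze (Suc k) v T else attach (Suc k) v T))
          \<le> height_gf z T (vertices T) + z * z ^ vertex_height T v" by simp
    qed
    also have "\<dots> = walk x k * height_gf z T (vertices T) + z * height_gf z T (active_vertices T)"
      using ne(4)[OF T] by (simp add: sum.distrib height_gf_def sum_distrib_left)
    finally show "(\<Sum>v\<in>active_vertices T. height_gf z
             (if x (Suc k) = - 1 then freeze (Suc k) v T else attach (Suc k) v T)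
             (vertices (if x (Suc k) = - 1 then freeze (Suc k) v T else attach (Suc k) v T))) / walk x k
        \<le> height_gf z T (vertices T) + z / walk x k * height_gf z T (active_vertices T)"
      using w by (simp add: field_simps)
  qed
  also have "\<dots> = ?G k + z / walk x k
      * measure_pmf.expectation (uaf x k) (\<lambda>T. height_gf z T (active_vertices T))"
    using int by (simp add: Bochner_Integration.integral_add)
  also have "\<dots> \<le> (1 + k * z * exp ((z - 1) * h_plus x n)) + z * exp ((z - 1) * h_plus x n)"
  proof (rule add_mono[OF Suc.IH[OF k]])
    have "z / walk x k * measure_pmf.expectation (uaf x k) (\<lambda>T. height_gf z T (active_vertices T))
        \<le> z / walk x k * (walk x k * exp ((z - 1) * h_plus x k))"
      using assms w by (intro mult_left_mono expectation_active_gf_le k) auto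
    also have "\<dots> = z * exp ((z - 1) * h_plus x k)" using w by simp
    also have "\<dots> \<le> z * exp ((z - 1) * h_plus x n)"
      using assms h_plus_mono[OF k order_refl] by (auto intro!: mult_left_mono)
    finally show "z / walk x k * measure_pmf.expectation (uaf x k) (\<lambda>T. height_gf z T (active_vertices T))
        \<le> z * exp ((z - 1) * h_plus x n)" .
  qed
  finally show ?case by (simp add: algebra_simps)
qed

section \<open>Concentration of the heights\<close>

lemma expectation_uaf_active:
  fixes F :: "ltree \<Rightarrow> nat \<Rightarrow> real"
  shows "measure_pmf.expectation (uaf_active x n) (\<lambda>(T, u). F T u)
    = measure_pmf.expectation (uaf x n) (\<lambda>T. (\<Sum>u\<in>active_vertices T. F T u) / walk x n)"
proof -
  note ne = uaf_active_nonempty[OF order_refl]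
  show ?thesis
    unfolding uaf_active_def
    apply (subst expectation_bind_finite)
    subgoal using finite_set_pmf_uaf[OF order_refl] .
    subgoal using ne by auto
    apply (rule expectation_cong_support)
    using ne by (simp add: integral_pmf_of_set)
qed

lemma exp_moment_active:
  fixes \<theta> :: real
  shows "measure_pmf.expectation (uaf_active x n) (\<lambda>(T, u). exp (\<theta> * vertex_height T u))
    \<le> exp ((exp \<theta> - 1) * h_plus x n)"
proof -
  have w: "real_of_int (walk x n) \<ge> 1" using walk_pos[of n] by simp
  have "measure_pmf.expectation (uaf_active x n) (\<lambda>(T, u). exp (\<theta> * vertex_height T u))
    = measure_pmf.expectation (uaf x n) (\<lambda>T. height_gf (exp \<theta>) T (active_vertices T)) / walk x n"
    unfolding expectation_uaf_active height_gf_def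
    by (simp add: exp_of_nat2_mult)
  also have "\<dots> \<le> (walk x n * exp ((exp \<theta> - 1) * h_plus x n)) / walk x n"
    using w by (intro divide_right_mono expectation_active_gf_le) auto
  finally show ?thesis using w by simp
qed

text \<open>
  The variance of the height is at most its mean, so fluctuations are measured in units of
  \<open>sqrt (h_plus x n)\<close>. For \<open>\<bar>\<theta>\<bar> \<le> 1\<close>, \<open>exp \<theta> - 1 - \<theta> \<le> \<theta>\<^sup>2\<close>, and \<open>\<theta> = \<plusminus> 1 / sqrt (h_plus x n)\<close>
  makes the resulting exponent \<open>\<theta>\<^sup>2 * h_plus x n\<close> equal to one.
\<close>

lemma exp_moment_active_centred:
  assumes h: "1 \<le> h_plus x n"
  shows "measure_pmf.expectation (uaf_active x n)
      (\<lambda>(T, u). exp (\<bar>vertex_height T u - h_plus x n\<bar> / sqrt (h_plus x n))) \<le> 2 * exp 1"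
proof -
  let ?h = "h_plus x n"
  let ?E = "measure_pmf.expectation (uaf_active x n)"
  have one_sided: "?E (\<lambda>(T, u). exp (\<theta> * (vertex_height T u - ?h))) \<le> exp 1"
    if th: "exp \<theta> - 1 - \<theta> \<le> \<theta>\<^sup>2" "\<theta>\<^sup>2 * ?h = 1" for \<theta> :: real
  proof -
    have "?E (\<lambda>(T, u). exp (\<theta> * (vertex_height T u - ?h)))
        = exp (- \<theta> * ?h) * ?E (\<lambda>(T, u). exp (\<theta> * vertex_height T u))"
      unfolding Bochner_Integration.integral_mult_right_zero[symmetric]
      by (intro Bochner_Integration.integral_cong) (auto simp: exp_add[symmetric] algebra_simps)
    also have "\<dots> \<le> exp (- \<theta> * ?h) * exp ((exp \<theta> - 1) * ?h)"
      by (intro mult_left_mono exp_moment_active) auto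
    also have "\<dots> = exp ((exp \<theta> - 1 - \<theta>) * ?h)" by (simp add: exp_add[symmetric] algebra_simps)
    also have "\<dots> \<le> exp (\<theta>\<^sup>2 * ?h)"
      unfolding exp_le_cancel_iff using th(1) h by (intro mult_right_mono) auto
    finally show ?thesis using th by simp
  qed
  define \<theta> where "\<theta> = 1 / sqrt ?h"
  have th: "0 \<le> \<theta>" "\<theta> \<le> 1" "\<theta>\<^sup>2 * ?h = 1"
    using h by (auto simp: \<theta>_def power_divide)
  have "exp \<theta> - 1 - \<theta> \<le> \<theta>\<^sup>2" using exp_bound[of \<theta>] th by simp
  moreover have "exp (- \<theta>) - 1 - (- \<theta>) \<le> (- \<theta>)\<^sup>2"
  proof -
    have "exp (- \<theta>) = 1 / exp \<theta>" by (simp add: exp_minus field_simps)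
    also have "\<dots> \<le> 1 / (1 + \<theta>)"
      using th exp_ge_add_one_self[of \<theta>] by (intro divide_left_mono) auto
    also have "\<dots> \<le> 1 - \<theta> + \<theta>\<^sup>2"
    proof -
      have "(1 - \<theta> + \<theta>\<^sup>2) * (1 + \<theta>) = 1 + \<theta> ^ 3" by (simp add: algebra_simps power2_eq_square power3_eq_cube)
      then have "1 \<le> (1 - \<theta> + \<theta>\<^sup>2) * (1 + \<theta>)" using th by simp
      then show ?thesis using th by (simp add: pos_divide_le_eq)
    qed
    finally show ?thesis by simp
  qed
  ultimately have sides: "?E (\<lambda>(T, u). exp (\<theta> * (vertex_height T u - ?h))) \<le> exp 1"
    "?E (\<lambda>(T, u). exp (- \<theta> * (vertex_height T u - ?h))) \<le> exp 1"
    using one_sided[of \<theta>] one_sided[of "- \<theta>"] th by auto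
  have int: "integrable (measure_pmf (uaf_active x n)) f" for f :: "ltree \<times> nat \<Rightarrow> real"
    using finite_set_pmf_uaf_active by (rule integrable_measure_pmf_finite)
  have "?E (\<lambda>(T, u). exp (\<bar>vertex_height T u - ?h\<bar> / sqrt ?h))
      \<le> ?E (\<lambda>y. (case y of (T, u) \<Rightarrow> exp (\<theta> * (vertex_height T u - ?h)))
          + (case y of (T, u) \<Rightarrow> exp (- \<theta> * (vertex_height T u - ?h))))"
  proof (rule expectation_mono_finite[OF finite_set_pmf_uaf_active], clarify)
    fix T u
    have eq: "\<bar>real (vertex_height T u) - ?h\<bar> / sqrt ?h = \<bar>\<theta> * (vertex_height T u - ?h)\<bar>"
      using th by (simp add: \<theta>_def abs_mult)
    have "exp \<bar>y\<bar> \<le> exp y + exp (- y)" for y :: real by (cases "0 \<le> y") auto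
    from this[of "\<theta> * (vertex_height T u - ?h)"]
    show "exp (\<bar>real (vertex_height T u) - ?h\<bar> / sqrt ?h)
      \<le> exp (\<theta> * (vertex_height T u - ?h)) + exp (- \<theta> * (vertex_height T u - ?h))"
      unfolding eq by simp
  qed
  also have "\<dots> = ?E (\<lambda>(T, u). exp (\<theta> * (vertex_height T u - ?h)))
      + ?E (\<lambda>(T, u). exp (- \<theta> * (vertex_height T u - ?h)))"
    by (intro Bochner_Integration.integral_add int)
  finally show ?thesis using sides by simp
qed

lemma active_height_Lp:
  assumes h: "1 \<le> h_plus x n" and p: "1 \<le> p"
  shows "measure_pmf.expectation (uaf_active x n)
      (\<lambda>(T, u). \<bar>vertex_height T u / h_plus x n - 1\<bar> powr p)
    \<le> 2 * exp 1 * p powr p * (1 / sqrt (h_plus x n)) powr p"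
proof -
  let ?h = "h_plus x n" and ?E = "measure_pmf.expectation (uaf_active x n)"
  let ?c = "p powr p * (1 / sqrt ?h) powr p"
  have "?E (\<lambda>(T, u). \<bar>vertex_height T u / ?h - 1\<bar> powr p)
      \<le> ?E (\<lambda>y. ?c * (case y of (T, u) \<Rightarrow> exp (\<bar>vertex_height T u - ?h\<bar> / sqrt ?h)))"
  proof (rule expectation_mono_finite[OF finite_set_pmf_uaf_active], clarify)
    fix T u
    let ?t = "\<bar>vertex_height T u - ?h\<bar> / sqrt ?h"
    have "\<bar>vertex_height T u / ?h - 1\<bar> = \<bar>vertex_height T u - ?h\<bar> / ?h"
      using h by (simp add: diff_divide_distrib[symmetric] field_simps abs_divide)
    also have "\<dots> = ?t * (1 / sqrt ?h)" using h by (simp add: field_simps)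
    finally have "\<bar>vertex_height T u / ?h - 1\<bar> powr p = (?t * (1 / sqrt ?h)) powr p" by simp
    also have "\<dots> = ?t powr p * (1 / sqrt ?h) powr p" using h by (subst powr_mult) auto
    also have "\<dots> \<le> (p powr p * exp ?t) * (1 / sqrt ?h) powr p"
      using h p by (intro mult_right_mono powr_le_exp) auto
    finally show "\<bar>vertex_height T u / ?h - 1\<bar> powr p \<le> ?c * exp ?t"
      by (simp add: mult_ac)
  qed
  also have "\<dots> = ?c * ?E (\<lambda>(T, u). exp (\<bar>vertex_height T u - ?h\<bar> / sqrt ?h))" by simp
  also have "\<dots> \<le> ?c * (2 * exp 1)"
    by (intro mult_left_mono exp_moment_active_centred h) auto
  finally show ?thesis by (simp add: mult_ac)
qed

text \<open>
  In every tree the shortfall of the height of the tree is at most that of each active vertex,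
  hence at most the average over the active vertices.
\<close>

lemma tree_height_lower_Lp:
  assumes h: "0 < h_plus x n" and p: "1 \<le> p"
  shows "measure_pmf.expectation (uaf x n) (\<lambda>T. max 0 (1 - tree_height T / h_plus x n) powr p)
    \<le> measure_pmf.expectation (uaf_active x n)
      (\<lambda>(T, u). \<bar>vertex_height T u / h_plus x n - 1\<bar> powr p)"
  unfolding expectation_uaf_active
proof (rule expectation_mono_finite[OF finite_set_pmf_uaf[OF order_refl]])
  let ?h = "h_plus x n"
  fix T assume T: "T \<in> set_pmf (uaf x n)"
  note ne = uaf_active_nonempty[OF order_refl T]
  have w: "real_of_int (walk x n) \<ge> 1" using walk_pos[of n] by simp
  have "walk x n * max 0 (1 - tree_height T / ?h) powr p
      = (\<Sum>u\<in>active_vertices T. max 0 (1 - tree_height T / ?h) powr p)"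
    using ne by simp
  also have "\<dots> \<le> (\<Sum>u\<in>active_vertices T. \<bar>vertex_height T u / ?h - 1\<bar> powr p)"
  proof (intro sum_mono powr_mono2)
    fix u assume "u \<in> active_vertices T"
    then have "u \<in> vertices T" using active_vertices_subset by blast
    then have "real (vertex_height T u) / ?h \<le> tree_height T / ?h"
      using vertex_height_le_tree_height[OF ne(1)] h by (simp add: divide_right_mono)
    then show "max 0 (1 - tree_height T / ?h) \<le> \<bar>vertex_height T u / ?h - 1\<bar>" by linarith
  qed (use p in auto)
  finally show "max 0 (1 - tree_height T / ?h) powr p
      \<le> (\<Sum>u\<in>active_vertices T. \<bar>vertex_height T u / ?h - 1\<bar> powr p) / walk x n"
    using w by (simp add: pos_le_divide_eq mult.commute)
qed

text \<open>
  A union bound: the highest vertex contributes one term to the sum over all vertices.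
\<close>

lemma exp_moment_tree_height:
  fixes \<theta> :: real
  assumes "0 \<le> \<theta>"
  shows "measure_pmf.expectation (uaf x n) (\<lambda>T. exp (\<theta> * tree_height T))
    \<le> (1 + n * exp \<theta>) * exp ((exp \<theta> - 1) * h_plus x n)"
proof -
  have h: "0 \<le> h_plus x n" using h_plus_mono[of 0 n] by simp
  have "measure_pmf.expectation (uaf x n) (\<lambda>T. exp (\<theta> * tree_height T))
      \<le> measure_pmf.expectation (uaf x n) (\<lambda>T. height_gf (exp \<theta>) T (vertices T))"
  proof (rule expectation_mono_finite[OF finite_set_pmf_uaf[OF order_refl]])
    fix T assume T: "T \<in> set_pmf (uaf x n)"
    show "exp (\<theta> * tree_height T) \<le> height_gf (exp \<theta>) T (vertices T)"
      unfolding exp_of_nat2_mult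
      using uaf_active_nonempty(1)[OF order_refl T] by (rule power_tree_height_le_gf) simp
  qed
  also have "\<dots> \<le> 1 + n * exp \<theta> * exp ((exp \<theta> - 1) * h_plus x n)"
    using assms by (intro expectation_vertices_gf_le) auto
  also have "\<dots> \<le> (1 + n * exp \<theta>) * exp ((exp \<theta> - 1) * h_plus x n)"
    using assms h by (simp add: distrib_right)
  finally show ?thesis .
qed

text \<open>
  The exponential moment at \<open>\<theta> = 1\<close>. With a general \<open>\<theta>\<close> and level \<open>c * h_plus x n\<close>, and \<open>n\<close> bounded
  by a multiple of \<open>exp (h_plus x n)\<close>, the exponent is \<open>(exp \<theta> - \<theta> * c) * h_plus x n\<close>; it can be made
  negative when \<open>c > exp \<theta> / \<theta>\<close>, and the minimum of \<open>exp \<theta> / \<theta>\<close> is \<open>e\<close>, reached at \<open>\<theta> = 1\<close>.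
\<close>

lemma prob_tree_height_large:
  shows "measure_pmf.prob (uaf x n) {T. (exp 1 + \<epsilon>) * h_plus x n < tree_height T}
    \<le> 4 * exp 1 * exp (- \<epsilon> * h_plus x n)"
proof -
  let ?h = "h_plus x n" and ?E = "measure_pmf.expectation (uaf x n)"
  let ?c = "exp (- (exp 1 + \<epsilon>) * ?h)"
  have "measure_pmf.prob (uaf x n) {T. (exp 1 + \<epsilon>) * ?h < tree_height T}
      \<le> ?E (\<lambda>T. ?c * exp (1 * tree_height T))"
    by (rule prob_le_expectation[OF finite_set_pmf_uaf[OF order_refl]])
      (auto simp: exp_add[symmetric] algebra_simps)
  also have "\<dots> = ?c * ?E (\<lambda>T. exp (1 * tree_height T))" by simp
  also have "\<dots> \<le> ?c * ((1 + n * exp 1) * exp ((exp 1 - 1) * ?h))"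
    using exp_moment_tree_height[of 1] by (intro mult_left_mono) auto
  also have "\<dots> = (1 + n * exp 1) * exp (- (1 + \<epsilon>) * ?h)"
    by (simp add: exp_add[symmetric] algebra_simps)
  also have "\<dots> \<le> (4 * exp 1 * exp ?h) * exp (- (1 + \<epsilon>) * ?h)"
  proof (rule mult_right_mono)
    have "1 + n * exp 1 \<le> (real n + 4) * exp 1"
      using exp_ge_add_one_self[of 1] by (simp add: distrib_right)
    also have "\<dots> \<le> (4 * exp ?h) * exp 1" using exp_h_plus_ge by (intro mult_right_mono) auto
    finally show "1 + n * exp 1 \<le> 4 * exp 1 * exp ?h" by (simp add: mult_ac)
  qed simp
  also have "\<dots> = 4 * exp 1 * exp (- \<epsilon> * ?h)" by (simp add: exp_add[symmetric] algebra_simps)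
  finally show ?thesis .
qed

text \<open>
  With \<open>b = ln n + 2\<close>, the union bound costs a factor \<open>exp b\<close> and the second-order term
  \<open>\<theta>\<^sup>2 * h_plus x n\<close> another one when \<open>\<theta> = sqrt (b / h_plus x n)\<close>. Hence \<open>\<theta>\<close> times the excess of
  the height exceeds \<open>2 * b\<close> with exponentially small tails, and \<open>2 * b / (\<theta> * h_plus x n) = 2 * \<theta>\<close>.
\<close>

lemma tree_height_upper_Lp:
  assumes n: "1 \<le> n" and b: "ln n + 2 \<le> h_plus x n" and p: "1 \<le> p"
  shows "measure_pmf.expectation (uaf x n) (\<lambda>T. max 0 (tree_height T / h_plus x n - 1) powr p)
    \<le> (1 + exp 1 * p powr p) * (2 * sqrt ((ln n + 2) / h_plus x n)) powr p"
proof -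
  let ?h = "h_plus x n" and ?E = "measure_pmf.expectation (uaf x n)"
  define b where "b = ln n + 2"
  define \<theta> where "\<theta> = sqrt (b / ?h)"
  have b2: "2 \<le> b" using n by (simp add: b_def)
  have h: "b \<le> ?h" "0 < ?h" using b b2 by (auto simp: b_def)
  have th: "0 < \<theta>" "\<theta> \<le> 1" "\<theta>\<^sup>2 * ?h = b" using h b2 by (auto simp: \<theta>_def)
  define W where "W = (\<lambda>T. \<theta> * (tree_height T - ?h) - 2 * b)"
  have "?E (\<lambda>T. exp (W T)) = exp (- \<theta> * ?h - 2 * b) * ?E (\<lambda>T. exp (\<theta> * tree_height T))"
    unfolding Bochner_Integration.integral_mult_right_zero[symmetric]
    by (intro Bochner_Integration.integral_cong) (auto simp: W_def exp_add[symmetric] algebra_simps)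
  also have "\<dots> \<le> exp (- \<theta> * ?h - 2 * b) * ((1 + n * exp \<theta>) * exp ((exp \<theta> - 1) * ?h))"
    using th by (intro mult_left_mono exp_moment_tree_height) auto
  also have "\<dots> = (1 + n * exp \<theta>) * exp ((exp \<theta> - 1 - \<theta>) * ?h - 2 * b)"
    by (simp add: exp_add[symmetric] algebra_simps)
  also have "\<dots> \<le> exp b * exp (- b)"
  proof (rule mult_mono)
    \<comment> \<open>The constant \<open>2\<close> in \<open>b\<close> is there for \<open>1 + e \<le> e\<^sup>2\<close>.\<close>
    have e: "exp (2::real) = exp 1 * exp 1" by (simp add: exp_add[symmetric])
    have e2: "exp (1::real) \<ge> 2" using exp_ge_add_one_self[of 1] by simp
    then have "2 * exp (1::real) \<le> exp 2" unfolding e by (intro mult_right_mono) auto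
    then have "1 + exp (1::real) \<le> exp 2" using e2 by linarith
    then have "n * (1 + exp (1::real)) \<le> n * exp 2" by (intro mult_left_mono) auto
    moreover have "1 + n * exp \<theta> \<le> n * (1 + exp (1::real))"
      using n th by (simp add: distrib_left add_mono mult_left_mono)
    ultimately have "1 + n * exp \<theta> \<le> n * exp 2" by linarith
    then show "1 + n * exp \<theta> \<le> exp b" using n by (simp add: b_def exp_add)
    have "(exp \<theta> - 1 - \<theta>) * ?h \<le> \<theta>\<^sup>2 * ?h"
      using exp_bound[of \<theta>] th h by (intro mult_right_mono) auto
    then show "exp ((exp \<theta> - 1 - \<theta>) * ?h - 2 * b) \<le> exp (- b)" using th by simp
  qed auto
  also have "\<dots> = 1" by (simp add: exp_add[symmetric])
  finally have W: "?E (\<lambda>T. exp (W T)) \<le> 1" .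
  have int: "integrable (measure_pmf (uaf x n)) f" for f :: "ltree \<Rightarrow> real"
    using finite_set_pmf_uaf[OF order_refl] by (rule integrable_measure_pmf_finite)
  have "?E (\<lambda>T. max 0 (tree_height T / ?h - 1) powr p)
      \<le> ?E (\<lambda>T. (2 * \<theta>) powr p * (1 + p powr p * exp 1 * exp (W T)))"
  proof (rule expectation_mono_finite[OF finite_set_pmf_uaf[OF order_refl]])
    fix T
    let ?y = "\<theta> * (tree_height T - ?h)"
    have "tree_height T / ?h - 1 = (2 * \<theta>) * (?y / (2 * b))"
      unfolding th(3)[symmetric] using th(1) h by (simp add: field_simps power2_eq_square)
    then have "max 0 (tree_height T / ?h - 1) = (2 * \<theta>) * max 0 (?y / (2 * b))"
      using th(1) max_mult_distrib_left[of "2 * \<theta>" 0 "?y / (2 * b)"] by simp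
    then have "max 0 (tree_height T / ?h - 1) powr p = (2 * \<theta>) powr p * max 0 (?y / (2 * b)) powr p"
      using th(1) by (simp add: powr_mult)
    also have "\<dots> \<le> (2 * \<theta>) powr p * (1 + p powr p * exp 1 * exp (?y - 2 * b))"
      using b2 p by (intro mult_left_mono powr_max_le_exp) auto
    finally show "max 0 (tree_height T / ?h - 1) powr p
        \<le> (2 * \<theta>) powr p * (1 + p powr p * exp 1 * exp (W T))" by (simp add: W_def)
  qed
  also have "\<dots> = (2 * \<theta>) powr p * (1 + p powr p * exp 1 * ?E (\<lambda>T. exp (W T)))"
    using int by (simp add: Bochner_Integration.integral_add measure_pmf.prob_space)
  also have "\<dots> \<le> (2 * \<theta>) powr p * (1 + p powr p * exp 1 * 1)"
    using W by (intro mult_left_mono add_left_mono) auto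
  finally show ?thesis by (simp add: \<theta>_def b_def mult_ac)
qed

end

theorem theorem3:
  fixes x :: "nat \<Rightarrow> nat \<Rightarrow> int"
  assumes signs: "\<And>n i. n \<ge> 1 \<Longrightarrow> i \<ge> 1 \<Longrightarrow> x n i \<in> {-1, 1}"
    and survival: "\<And>n. n \<ge> 1 \<Longrightarrow> hitting_time (x n) > enat n"
  shows
    "(\<forall>p::real. p \<ge> 1 \<longrightarrow>
        converges_in_Lp p (\<lambda>n. uaf_active (x n) n)
          (\<lambda>n (T, u). real (vertex_height T u) / h_plus (x n) n) 1)
     \<and> (\<forall>\<epsilon>::real. 0 < \<epsilon> \<and> \<epsilon> < 1 \<longrightarrow>
        (\<lambda>n. measure_pmf.prob (uaf (x n) n)
           {T. 1 - \<epsilon> \<le> real (tree_height T) / h_plus (x n) n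
             \<and> real (tree_height T) / h_plus (x n) n \<le> exp 1 + \<epsilon>}) \<longlonglongrightarrow> 1)
     \<and> ((\<lambda>n. ln (real n) / h_plus (x n) n) \<longlonglongrightarrow> 0 \<longrightarrow>
        (\<forall>p::real. p \<ge> 1 \<longrightarrow>
           converges_in_Lp p (\<lambda>n. uaf (x n) n)
             (\<lambda>n T. real (tree_height T) / h_plus (x n) n) 1))"
proof -
  define h where "h = (\<lambda>n. h_plus (x n) n)"
  have loc: "surviving_signs (x n) n" if "1 \<le> n" for n
    using signs survival that by unfold_locales auto
  have h_top: "filterlim h at_top sequentially"
  proof (rule filterlim_at_top_mono)
    have "filterlim (\<lambda>n. 1 / 4 * (4 + real n)) at_top sequentially"
      by (intro filterlim_tendsto_pos_mult_at_top[OF tendsto_const]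
          filterlim_tendsto_add_at_top[OF tendsto_const] filterlim_real_sequentially) simp
    then show "filterlim (\<lambda>n::nat. ln ((real n + 4) / 4)) at_top sequentially"
      by (intro filterlim_compose[OF ln_at_top]) (simp add: add.commute)
    show "\<forall>\<^sub>F n in sequentially. ln ((real n + 4) / 4) \<le> h n"
      using eventually_ge_at_top[of 1]
    proof eventually_elim
      case (elim n)
      then have "ln ((real n + 4) / 4) \<le> ln (exp (h n))"
        using surviving_signs.exp_h_plus_ge[OF loc] by (subst ln_le_cancel_iff) (auto simp: h_def)
      then show ?case by simp
    qed
  qed
  then have h_ge: "\<forall>\<^sub>F n in sequentially. c \<le> h n" for c
    by (simp add: filterlim_at_top)
  define A where "A = (\<lambda>p n. measure_pmf.expectation (uaf_active (x n) n)
      (\<lambda>(T, u). \<bar>vertex_height T u / h n - 1\<bar> powr p))"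
  have A_nonneg: "0 \<le> A p n" for p n unfolding A_def by (intro Bochner_Integration.integral_nonneg) auto
  have A_lim: "A p \<longlonglongrightarrow> 0" if p: "1 \<le> p" for p
  proof (rule tendsto_sandwich)
    show "\<forall>\<^sub>F n in sequentially. 0 \<le> A p n" using A_nonneg by simp
    show "\<forall>\<^sub>F n in sequentially. A p n \<le> 2 * exp 1 * p powr p * (1 / sqrt (h n)) powr p"
      using eventually_ge_at_top[of 1] h_ge[of 1]
      by eventually_elim (use surviving_signs.active_height_Lp[OF loc] p in \<open>auto simp: A_def h_def\<close>)
    have "(\<lambda>n. 1 / sqrt (h n)) \<longlonglongrightarrow> 0"
      by (intro tendsto_divide_0[OF tendsto_const] filterlim_at_top_imp_at_infinity
          filterlim_compose[OF sqrt_at_top h_top])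
    moreover have "\<forall>\<^sub>F n in sequentially. 0 \<le> 1 / sqrt (h n)"
      using h_ge[of 1] by eventually_elim auto
    ultimately have "(\<lambda>n. (1 / sqrt (h n)) powr p) \<longlonglongrightarrow> 0"
      using p by (intro tendsto_zero_powrI[where b=p]) auto
    then show "(\<lambda>n. 2 * exp 1 * p powr p * (1 / sqrt (h n)) powr p) \<longlonglongrightarrow> 0"
      by (rule tendsto_mult_right_zero)
  qed simp
  have part1: "converges_in_Lp p (\<lambda>n. uaf_active (x n) n)
          (\<lambda>n (T, u). real (vertex_height T u) / h_plus (x n) n) 1" if p: "1 \<le> p" for p
    unfolding converges_in_Lp_def
  proof (intro conjI allI impI)
    fix n :: nat assume "1 \<le> n"
    then show "integrable (measure_pmf (uaf_active (x n) n))
        (\<lambda>\<omega>. \<bar>case \<omega> of (T, u) \<Rightarrow> vertex_height T u / h_plus (x n) n\<bar> powr p)"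
      by (intro integrable_measure_pmf_finite surviving_signs.finite_set_pmf_uaf_active loc)
  next
    show "(\<lambda>n. measure_pmf.expectation (uaf_active (x n) n)
        (\<lambda>\<omega>. \<bar>(case \<omega> of (T, u) \<Rightarrow> vertex_height T u / h_plus (x n) n) - 1\<bar> powr p)) \<longlonglongrightarrow> 0"
      using A_lim[OF p] by (simp add: A_def h_def case_prod_beta')
  qed
  have part2: "(\<lambda>n. measure_pmf.prob (uaf (x n) n)
           {T. 1 - \<epsilon> \<le> real (tree_height T) / h_plus (x n) n
             \<and> real (tree_height T) / h_plus (x n) n \<le> exp 1 + \<epsilon>}) \<longlonglongrightarrow> 1"
    if eps: "0 < \<epsilon>" for \<epsilon> :: real
  proof (rule tendsto_sandwich)
    show "\<forall>\<^sub>F n in sequentially. measure_pmf.prob (uaf (x n) n)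
           {T. 1 - \<epsilon> \<le> real (tree_height T) / h_plus (x n) n
             \<and> real (tree_height T) / h_plus (x n) n \<le> exp 1 + \<epsilon>} \<le> 1" by simp
    show "\<forall>\<^sub>F n in sequentially. 1 - (A 1 n / \<epsilon> + 4 * exp 1 * exp (- \<epsilon> * h n))
        \<le> measure_pmf.prob (uaf (x n) n)
           {T. 1 - \<epsilon> \<le> real (tree_height T) / h_plus (x n) n
             \<and> real (tree_height T) / h_plus (x n) n \<le> exp 1 + \<epsilon>}"
      using eventually_ge_at_top[of 1] h_ge[of 1]
    proof eventually_elim
      case (elim n)
      interpret surviving_signs "x n" n using elim by (intro loc)
      let ?P = "measure_pmf.prob (uaf (x n) n)"
      let ?good = "{T. 1 - \<epsilon> \<le> real (tree_height T) / h_plus (x n) n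
             \<and> real (tree_height T) / h_plus (x n) n \<le> exp 1 + \<epsilon>}"
      \<comment> \<open>Markov's inequality for the first moment of the shortfall bounds the event \<open>?low\<close>.\<close>
      let ?low = "{T. tree_height T / h n < 1 - \<epsilon>}"
      let ?high = "{T. (exp 1 + \<epsilon>) * h_plus (x n) n < tree_height T}"
      have "1 - ?P ?good = ?P (- ?good)" by (simp add: measure_pmf.prob_compl[symmetric] Compl_eq_Diff_UNIV)
      also have "- ?good \<subseteq> ?low \<union> ?high" using elim by (auto simp: h_def field_simps)
      then have "?P (- ?good) \<le> ?P (?low \<union> ?high)"
        by (intro measure_pmf.finite_measure_mono) auto
      also have "\<dots> \<le> ?P ?low + ?P ?high" by (rule measure_Un_le) auto
      also have "?P ?high \<le> 4 * exp 1 * exp (- \<epsilon> * h n)"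
        unfolding h_def by (rule prob_tree_height_large)
      also have "?P ?low \<le> measure_pmf.expectation (uaf (x n) n)
          (\<lambda>T. max 0 (1 - tree_height T / h n) powr 1 / \<epsilon>)"
        using eps by (intro prob_le_expectation finite_set_pmf_uaf) (auto simp: field_simps)
      also have "\<dots> \<le> A 1 n / \<epsilon>"
        using tree_height_lower_Lp[of 1] elim eps
        by (simp add: A_def h_def divide_right_mono del: powr_one')
      finally show ?case by simp
    qed
    have "filterlim (\<lambda>n. - \<epsilon> * h n) at_bot sequentially"
      using eps by (intro filterlim_tendsto_neg_mult_at_bot[OF tendsto_const] h_top) auto
    then have "(\<lambda>n. 4 * exp 1 * exp (- \<epsilon> * h n)) \<longlonglongrightarrow> 0"
      by (intro tendsto_mult_right_zero filterlim_compose[OF exp_at_bot])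
    then have "(\<lambda>n. 1 - (A 1 n / \<epsilon> + 4 * exp 1 * exp (- \<epsilon> * h n))) \<longlonglongrightarrow> 1 - (0 / \<epsilon> + 0)"
      using eps by (intro tendsto_intros A_lim) auto
    then show "(\<lambda>n. 1 - (A 1 n / \<epsilon> + 4 * exp 1 * exp (- \<epsilon> * h n))) \<longlonglongrightarrow> 1" by simp
  qed simp
  have part3: "converges_in_Lp p (\<lambda>n. uaf (x n) n)
             (\<lambda>n T. real (tree_height T) / h_plus (x n) n) 1"
    if ln_h: "(\<lambda>n. ln (real n) / h_plus (x n) n) \<longlonglongrightarrow> 0" and p: "1 \<le> p" for p
    unfolding converges_in_Lp_def
  proof (intro conjI allI impI)
    fix n :: nat assume "1 \<le> n"
    then show "integrable (measure_pmf (uaf (x n) n)) (\<lambda>\<omega>. \<bar>tree_height \<omega> / h_plus (x n) n\<bar> powr p)"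
      by (intro integrable_measure_pmf_finite surviving_signs.finite_set_pmf_uaf[OF loc]) auto
  next
    have "(\<lambda>n. 2 * (1 / h n)) \<longlonglongrightarrow> 2 * 0"
      by (intro tendsto_intros tendsto_divide_0[OF tendsto_const] filterlim_at_top_imp_at_infinity h_top)
    then have b_lim: "(\<lambda>n. (ln n + 2) / h n) \<longlonglongrightarrow> 0"
      using tendsto_add[OF ln_h] by (fastforce simp: add_divide_distrib h_def)
    have b_le: "\<forall>\<^sub>F n in sequentially. (ln n + 2) / h n < 1"
      using b_lim by (rule order_tendstoD) simp
    let ?B = "\<lambda>n. (1 + exp 1 * p powr p) * (2 * sqrt ((ln n + 2) / h n)) powr p"
    show "(\<lambda>n. measure_pmf.expectation (uaf (x n) n)
        (\<lambda>T. \<bar>tree_height T / h_plus (x n) n - 1\<bar> powr p)) \<longlonglongrightarrow> 0"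
    proof (rule tendsto_sandwich)
      show "\<forall>\<^sub>F n in sequentially. 0 \<le> measure_pmf.expectation (uaf (x n) n)
        (\<lambda>T. \<bar>tree_height T / h_plus (x n) n - 1\<bar> powr p)"
        by (intro always_eventually allI Bochner_Integration.integral_nonneg) auto
      show "\<forall>\<^sub>F n in sequentially. measure_pmf.expectation (uaf (x n) n)
        (\<lambda>T. \<bar>tree_height T / h_plus (x n) n - 1\<bar> powr p) \<le> ?B n + A p n"
        using eventually_ge_at_top[of 1] h_ge[of 1] b_le
      proof eventually_elim
        case (elim n)
        interpret surviving_signs "x n" n using elim by (intro loc)
        let ?E = "measure_pmf.expectation (uaf (x n) n)"
        have int: "integrable (measure_pmf (uaf (x n) n)) f" for f :: "ltree \<Rightarrow> real"
          using finite_set_pmf_uaf[OF order_refl] by (rule integrable_measure_pmf_finite)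
        have "\<bar>y\<bar> powr p = max 0 y powr p + max 0 (- y) powr p" for y :: real
          using p by (cases "0 \<le> y") auto
        then have "?E (\<lambda>T. \<bar>tree_height T / h n - 1\<bar> powr p)
            = ?E (\<lambda>T. max 0 (tree_height T / h n - 1) powr p + max 0 (1 - tree_height T / h n) powr p)"
          by simp
        also have "\<dots> = ?E (\<lambda>T. max 0 (tree_height T / h n - 1) powr p)
            + ?E (\<lambda>T. max 0 (1 - tree_height T / h n) powr p)"
          by (intro Bochner_Integration.integral_add int)
        also have "\<dots> \<le> ?B n + A p n"
          unfolding A_def h_def using elim p
          by (intro add_mono tree_height_upper_Lp tree_height_lower_Lp) (auto simp: h_def field_simps)
        finally show ?case by (simp add: h_def)
      qed
      have "(\<lambda>n. 2 * sqrt ((ln n + 2) / h n)) \<longlonglongrightarrow> 2 * sqrt 0"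
        by (intro tendsto_intros b_lim)
      moreover have "\<forall>\<^sub>F n in sequentially. 0 \<le> 2 * sqrt ((ln n + 2) / h n)"
        using eventually_ge_at_top[of 1] h_ge[of 1] by eventually_elim auto
      ultimately have "(\<lambda>n. (2 * sqrt ((ln n + 2) / h n)) powr p) \<longlonglongrightarrow> 0"
        using p by (intro tendsto_zero_powrI[where b=p]) auto
      then have "(\<lambda>n. ?B n + A p n) \<longlonglongrightarrow> (1 + exp 1 * p powr p) * 0 + 0"
        using p by (intro tendsto_intros A_lim)
      then show "(\<lambda>n. ?B n + A p n) \<longlonglongrightarrow> 0" by simp
    qed simp
  qed
  show ?thesis using part1 part2 part3 by blast
qed

end
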